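(* Let $K$ be an infinite compact space and let $S$ be an infinite scattered compact space. Then the spaces $C_p(K)$ and $C_w(S)$ are not homeomorphic.
   Context: All topological spaces are assumed to be Tychonoff, so compact spaces are compact Hausdorff. For a compact space $K$, $C(K)$ denotes the Banach space of all real-valued continuous functions on $K$ with the supremum norm. $C_w(K)$ denotes the set $C(K)$ equipped with the weak topology of this Banach space (the weakest topology making all norm-continuous linear functionals on $C(K)$ continuous). $C_p(K)$ denotes the set $C(K)$ equipped with the pointwise topology, i.e. the topology inherited from the product space $\mathbb{R}^K$. A space $X$ is scattered if no nonempty subset $A\subseteq X$ is dense-in-itself (i.e. every nonempty subspace has an isolated point). *)

theory Defs
  imports "HOL-Analysis.Analysis"
begin

text \<open>A compact Hausdorff space \<open>K\<close> is modelled as a type of class \<^class>\<open>t2_space\<close> whose universe is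
  compact. For such a type every real-valued continuous function is bounded, so that the Banach
  space \<open>C(K)\<close> with the supremum norm is the library type of bounded continuous functions:\<close>

lemma range_apply_bcontfun_compact:
  assumes "compact (UNIV :: 'k::topological_space set)"
  shows "range (apply_bcontfun :: ('k \<Rightarrow>\<^sub>C real) \<Rightarrow> 'k \<Rightarrow> real) = {f. continuous_on UNIV f}"
proof -
  have "bounded (range f)" if "continuous_on UNIV f" for f :: "'k \<Rightarrow> real"
    using compact_continuous_image[OF that assms] by (rule compact_imp_bounded)
  then show ?thesis
    by (auto simp: type_definition.Rep_range[OF type_definition_bcontfun] bcontfun_def)
qed

definition weak_topology :: "'v::real_normed_vector topology" where
  "weak_topology =
     topology_generated_by {\<phi> -` U | (\<phi> :: 'v \<Rightarrow> real) U. bounded_linear \<phi> \<and> open U}"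

definition pointwise_topology :: "('k::topological_space \<Rightarrow>\<^sub>C real) topology" where
  "pointwise_topology =
     pullback_topology UNIV apply_bcontfun (product_topology (\<lambda>_::'k. euclideanreal) UNIV)"

definition dense_in_itself :: "'a::topological_space set \<Rightarrow> bool" where
  "dense_in_itself A \<longleftrightarrow> (\<forall>x\<in>A. x islimpt A)"

definition scattered :: "'a::topological_space set \<Rightarrow> bool" where
  "scattered X \<longleftrightarrow> \<not> (\<exists>A\<subseteq>X. A \<noteq> {} \<and> dense_in_itself A)"

end

theory Submission
  imports Defs
begin

text \<open>Suppose \<open>h : C\<^sub>p(K) \<rightarrow> C\<^sub>w(S)\<close> is a homeomorphism. The preimages of the multiples of the unit ball of
  \<open>C(S)\<close> are norm closed and cover \<open>C(K)\<close>, so by Baire's theorem \<open>h\<close> is norm bounded on some ball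
  \<open>B\<close> of \<open>C(K)\<close>. Since \<open>S\<close> is scattered, norm bounded subsets of \<open>C\<^sub>w(S)\<close> are Frechet--Urysohn: this
  holds pointwise, because countably many continuous functions on \<open>S\<close> take only countably many joint
  values, and bounded pointwise convergent sequences in \<open>C(S)\<close> converge weakly. Composition with a
  homeomorphism of \<open>\<real>\<close> onto a bounded interval embeds \<open>C\<^sub>p(K)\<close> into \<open>B\<close>, so \<open>C\<^sub>p(K)\<close> and hence
  \<open>C\<^sub>w(S)\<close> is Frechet--Urysohn. But the functions \<open>f\<close> with \<open>f(p) > 0\<close> and \<open>\<parallel>f\<parallel> f(p) \<ge> 1\<close> accumulate
  weakly at \<open>0\<close>, while no sequence of them converges weakly to \<open>0\<close>, as it would be norm bounded.\<close>

subsection \<open>The weak and the pointwise topology\<close>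

lemma openin_weak_topology_vimage:
  fixes \<phi> :: "'a::real_normed_vector \<Rightarrow> real"
  assumes "bounded_linear \<phi>" "open U"
  shows "openin weak_topology (\<phi> -` U)"
proof -
  have "\<exists>(\<psi> :: 'a \<Rightarrow> real) V. \<phi> -` U = \<psi> -` V \<and> bounded_linear \<psi> \<and> open V"
    using assms by (intro exI[of _ \<phi>] exI[of _ U]) simp
  then show ?thesis
    unfolding weak_topology_def by (intro topology_generated_by_Basis CollectI)
qed

lemma topspace_weak_topology [simp]: "topspace weak_topology = UNIV"
  using openin_subset[OF openin_weak_topology_vimage[OF bounded_linear_zero open_UNIV]] by auto

lemma continuous_map_weak_topology:
  assumes "bounded_linear \<phi>"
  shows "continuous_map weak_topology euclideanreal \<phi>"
  using openin_weak_topology_vimage[OF assms]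
  by (simp add: continuous_map_def vimage_def)

text \<open>Induction on how \<open>U\<close> is generated: an intersection merges the two finite
  families and takes the smaller radius, a union keeps one member, and a generator uses that
  \<open>V\<close> contains an interval about \<open>\<phi> x\<close>.\<close>

lemma weak_topology_nhd_contains_basis:
  assumes "openin weak_topology U" "x \<in> U"
  shows "\<exists>\<Phi> e. finite \<Phi> \<and> (\<forall>\<phi>\<in>\<Phi>. bounded_linear \<phi>) \<and> e > 0 \<and>
      {y. \<forall>\<phi>\<in>\<Phi>. \<bar>\<phi> y - \<phi> x\<bar> < (e::real)} \<subseteq> U"
proof -
  have "generate_topology_on {\<phi> -` U | (\<phi> :: 'a \<Rightarrow> real) U. bounded_linear \<phi> \<and> open U} U"
    using assms(1) unfolding weak_topology_def by (rule openin_topology_generated_by)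
  then show ?thesis
    using assms(2)
  proof (induction arbitrary: x)
    case Empty
    then show ?case by simp
  next
    case (Int U V)
    obtain \<Phi> d where 1: "finite \<Phi>" "\<forall>\<phi>\<in>\<Phi>. bounded_linear \<phi>" "d > 0"
      "{y. \<forall>\<phi>\<in>\<Phi>. \<bar>\<phi> y - \<phi> x\<bar> < (d::real)} \<subseteq> U"
      using Int.IH(1)[of x] Int.prems by auto
    obtain \<Psi> e where 2: "finite \<Psi>" "\<forall>\<phi>\<in>\<Psi>. bounded_linear \<phi>" "e > 0"
      "{y. \<forall>\<phi>\<in>\<Psi>. \<bar>\<phi> y - \<phi> x\<bar> < (e::real)} \<subseteq> V"
      using Int.IH(2)[of x] Int.prems by auto
    show ?case
      by (rule exI[of _ "\<Phi> \<union> \<Psi>"], rule exI[of _ "min d e"]) (use 1 2 in auto)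
  next
    case (UN K)
    then obtain k where k: "k \<in> K" "x \<in> k" by blast
    obtain \<Phi> d where "finite \<Phi>" "\<forall>\<phi>\<in>\<Phi>. bounded_linear \<phi>" "d > 0"
      "{y. \<forall>\<phi>\<in>\<Phi>. \<bar>\<phi> y - \<phi> x\<bar> < (d::real)} \<subseteq> k"
      using UN.IH[OF k] by auto
    then show ?case
      using k by (intro exI[of _ \<Phi>] exI[of _ d]) auto
  next
    case (Basis s)
    then obtain \<phi> :: "'a \<Rightarrow> real" and V where s: "s = \<phi> -` V" "bounded_linear \<phi>" "open V" by blast
    moreover have "\<phi> x \<in> V" using s Basis by simp
    ultimately obtain e where "e > 0" "\<forall>y. \<bar>y - \<phi> x\<bar> < e \<longrightarrow> y \<in> V"
      unfolding open_dist dist_real_def by blast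
    then show ?case
      by (intro exI[of _ "{\<phi>}"] exI[of _ e]) (use s in auto)
  qed
qed

lemma in_closure_of_weak_topology:
  "x \<in> weak_topology closure_of A \<longleftrightarrow>
    (\<forall>\<Phi> e. finite \<Phi> \<longrightarrow> (\<forall>\<phi>\<in>\<Phi>. bounded_linear \<phi>) \<longrightarrow> e > 0 \<longrightarrow>
      (\<exists>y\<in>A. \<forall>\<phi>\<in>\<Phi>. \<bar>\<phi> y - \<phi> x\<bar> < (e::real)))"
  (is "?L \<longleftrightarrow> ?R")
proof
  assume L: ?L
  show ?R
  proof (intro allI impI)
    fix \<Phi> :: "('a \<Rightarrow> real) set" and e :: real
    assume \<Phi>: "finite \<Phi>" "\<forall>\<phi>\<in>\<Phi>. bounded_linear \<phi>" and e: "e > 0"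
    define U where "U = topspace weak_topology \<inter> (\<Inter>\<phi>\<in>\<Phi>. \<phi> -` ball (\<phi> x) e)"
    have "openin weak_topology (UNIV :: 'a set)"
      using openin_topspace[of weak_topology] by simp
    then have "openin weak_topology U"
      unfolding U_def using \<Phi>
      by (intro openin_Int_Inter) (auto intro: openin_weak_topology_vimage)
    moreover have "x \<in> U" using e by (simp add: U_def)
    ultimately obtain y where "y \<in> A" "y \<in> U"
      using L unfolding in_closure_of by blast
    then show "\<exists>y\<in>A. \<forall>\<phi>\<in>\<Phi>. \<bar>\<phi> y - \<phi> x\<bar> < e"
      by (intro bexI[of _ y]) (auto simp: U_def dist_real_def abs_minus_commute)
  qed
next
  assume R: ?R
  show ?L
    unfolding in_closure_of
  proof (intro conjI allI impI)
    fix T assume "x \<in> T \<and> openin weak_topology T"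
    then obtain \<Phi> and e :: real where *: "finite \<Phi>" "\<forall>\<phi>\<in>\<Phi>. bounded_linear \<phi>" "e > 0"
      "{y. \<forall>\<phi>\<in>\<Phi>. \<bar>\<phi> y - \<phi> x\<bar> < e} \<subseteq> T"
      using weak_topology_nhd_contains_basis[of T x] by auto
    then obtain y where "y \<in> A" "\<forall>\<phi>\<in>\<Phi>. \<bar>\<phi> y - \<phi> x\<bar> < e"
      using R[rule_format, of \<Phi> e] by auto
    then show "\<exists>y. y \<in> A \<and> y \<in> T" using * by blast
  qed simp
qed

text \<open>The weak topology is initial for the functionals, and a basic neighbourhood constrains
  only finitely many of them, so finitely many eventualities combine.\<close>

lemma limitin_weak_topology:
  "limitin weak_topology f l F \<longleftrightarrow>
    (\<forall>\<phi>. bounded_linear \<phi> \<longrightarrow> ((\<lambda>k. \<phi> (f k) :: real) \<longlongrightarrow> \<phi> l) F)"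
  (is "?L \<longleftrightarrow> ?R")
proof
  assume ?L
  then show ?R
    using continuous_map_limit[OF continuous_map_weak_topology, of _ f l F] by (auto simp: o_def)
next
  assume R: ?R
  show ?L
    unfolding limitin_def
  proof (intro conjI allI impI)
    fix U assume "openin weak_topology U \<and> l \<in> U"
    then obtain \<Phi> and e :: real where *: "finite \<Phi>" "\<forall>\<phi>\<in>\<Phi>. bounded_linear \<phi>" "e > 0"
      "{y. \<forall>\<phi>\<in>\<Phi>. \<bar>\<phi> y - \<phi> l\<bar> < e} \<subseteq> U"
      using weak_topology_nhd_contains_basis[of U l] by auto
    have "\<forall>\<^sub>F k in F. \<forall>\<phi>\<in>\<Phi>. \<bar>\<phi> (f k) - \<phi> l\<bar> < e"
      using * R by (intro eventually_ball_finite) (auto simp: tendsto_iff dist_real_def)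
    then show "\<forall>\<^sub>F k in F. f k \<in> U"
    proof (rule eventually_mono)
      fix k assume "\<forall>\<phi>\<in>\<Phi>. \<bar>\<phi> (f k) - \<phi> l\<bar> < e"
      then show "f k \<in> U" using *(4) by auto
    qed
  qed simp
qed

section \<open>Continuity and convergence in the pointwise topology\<close>

lemma topspace_pointwise_topology [simp]: "topspace pointwise_topology = UNIV"
  by (simp add: pointwise_topology_def topspace_pullback_topology)

lemma continuous_map_into_pointwise_topology:
  "continuous_map X pointwise_topology f \<longleftrightarrow>
    (\<forall>x. continuous_map X euclideanreal (\<lambda>t. apply_bcontfun (f t) x))"
  (is "?L \<longleftrightarrow> ?R")
proof
  assume ?L
  then have "continuous_map X (product_topology (\<lambda>_. euclideanreal) UNIV) (apply_bcontfun \<circ> f)"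
    unfolding pointwise_topology_def
    by (rule continuous_map_compose) (intro continuous_map_pullback[of _ _ id, simplified] continuous_map_id)
  then show ?R
    by (auto simp: continuous_map_componentwise_UNIV)
next
  assume ?R
  then show ?L
    unfolding pointwise_topology_def
    by (intro continuous_map_pullback') (auto simp: continuous_map_componentwise_UNIV o_def)
qed

lemma continuous_map_pointwise_topology_apply:
  "continuous_map pointwise_topology euclideanreal
    (\<lambda>f :: 'a::topological_space \<Rightarrow>\<^sub>C real. apply_bcontfun f x)"
proof -
  have "continuous_map pointwise_topology pointwise_topology (\<lambda>f :: 'a \<Rightarrow>\<^sub>C real. f)"
    by simp
  then show ?thesis
    unfolding continuous_map_into_pointwise_topology by blast
qed

lemma limitin_pointwise_topology:
  "limitin pointwise_topology f l F \<longleftrightarrow>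
    (\<forall>x. ((\<lambda>k. apply_bcontfun (f k) x) \<longlongrightarrow> apply_bcontfun l x) F)"
  (is "?L \<longleftrightarrow> ?R")
proof
  assume ?L
  then show ?R
    using continuous_map_limit[OF continuous_map_pointwise_topology_apply, of f l F] by (auto simp: o_def)
next
  assume R: ?R
  show ?L
    unfolding limitin_def
  proof (intro conjI allI impI)
    fix U :: "('a \<Rightarrow>\<^sub>C real) set"
    assume "openin pointwise_topology U \<and> l \<in> U"
    then obtain V where V: "openin (product_topology (\<lambda>_. euclideanreal) UNIV) V"
      "U = apply_bcontfun -` V" "apply_bcontfun l \<in> V"
      by (auto simp: pointwise_topology_def openin_pullback_topology)
    from product_topology_open_contains_basis[OF V(1,3)]
    obtain X where X: "apply_bcontfun l \<in> Pi UNIV X" "\<And>x. open (X x)" "finite {x. X x \<noteq> UNIV}"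
      "Pi UNIV X \<subseteq> V"
      by (auto simp: PiE_UNIV_domain)
    have "apply_bcontfun l x \<in> X x" for x
      using X(1) by auto
    then have "\<forall>\<^sub>F k in F. f k x \<in> X x" for x
      using R X(2) by (auto simp: tendsto_def)
    then have "\<forall>\<^sub>F k in F. \<forall>x\<in>{x. X x \<noteq> UNIV}. f k x \<in> X x"
      using X(3) by (intro eventually_ball_finite) auto
    then show "\<forall>\<^sub>F k in F. f k \<in> U"
    proof (rule eventually_mono)
      fix k assume "\<forall>x\<in>{x. X x \<noteq> UNIV}. f k x \<in> X x"
      then have "apply_bcontfun (f k) \<in> Pi UNIV X" by auto
      then show "f k \<in> U" using X V by auto
    qed
  qed simp
qed

lemma abs_apply_bcontfun_le_norm: "\<bar>apply_bcontfun f x\<bar> \<le> norm f"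
  using norm_bounded[of f x] by simp

lemma bounded_linear_apply_bcontfun:
  "bounded_linear (\<lambda>f :: 'a::topological_space \<Rightarrow>\<^sub>C real. apply_bcontfun f x)"
  by (rule bounded_linear_intro[where K = 1]) (simp_all add: abs_apply_bcontfun_le_norm)

subsection \<open>Baire category\<close>

text \<open>The library instance of \<^class>\<open>complete_space\<close> for bounded continuous functions requires a metric
  domain.\<close>

lemma complete_UNIV_bcontfun:
  "complete (UNIV :: ('a::topological_space \<Rightarrow>\<^sub>C 'b::complete_space) set)"
  unfolding complete_def
proof (intro allI impI)
  fix f :: "nat \<Rightarrow> 'a \<Rightarrow>\<^sub>C 'b"
  assume "(\<forall>n. f n \<in> UNIV) \<and> Cauchy f"
  then have "\<forall>e>0. \<exists>N. \<forall>m n x. N \<le> m \<and> N \<le> n \<longrightarrow>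
      dist (apply_bcontfun (f m) x) (apply_bcontfun (f n) x) < e"
    unfolding Cauchy_def by (metis dist_fun_lt_imp_dist_val_lt)
  then obtain g where "uniform_limit UNIV (\<lambda>n. apply_bcontfun (f n)) g sequentially"
    using uniformly_convergent_eq_cauchy[of "\<lambda>_. True" "\<lambda>n. apply_bcontfun (f n)"]
    by (auto simp: uniform_limit_sequentially_iff)
  then obtain l where "f \<longlonglongrightarrow> l"
    by (rule uniform_limit_bcontfunE[OF _ sequentially_bot])
  then show "\<exists>l\<in>UNIV. f \<longlonglongrightarrow> l" by blast
qed

text \<open>Baire: if every \<open>C n\<close> had empty interior, so would their union.
  Completeness is an explicit hypothesis so that the lemma serves both the dual space and
  \<open>C(K)\<close>.\<close>

lemma closed_cover_contains_cball:
  fixes C :: "nat \<Rightarrow> 'v::metric_space set"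
  assumes complete: "complete (UNIV :: 'v set)" and "\<And>n. closed (C n)" "(\<Union>n. C n) = UNIV"
  obtains n x r where "r > 0" "cball x r \<subseteq> C n"
proof -
  have "completely_metrizable_space (euclidean :: 'v topology)"
    using Met_TC.completely_metrizable_space_mtopology complete by auto
  have "\<exists>n. interior (C n) \<noteq> {}"
  proof (rule ccontr)
    assume "\<nexists>n. interior (C n) \<noteq> {}"
    then have "euclidean interior_of \<Union>(range C) = {}"
      by (intro Baire_category_alt) (use assms \<open>completely_metrizable_space euclidean\<close> in auto)
    then show False using assms by simp
  qed
  then obtain n x where "x \<in> interior (C n)" by blast
  then show thesis using that by (meson mem_interior_cball)
qed

text \<open>Uniform boundedness via Baire in the dual. Evaluations at points have norm at most 1 and
  determine the supremum norm, so they replace an appeal to Hahn-Banach.\<close>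

lemma weakly_bounded_imp_bounded:
  fixes F :: "('a::topological_space \<Rightarrow>\<^sub>C real) set"
  assumes "\<And>\<phi> :: ('a \<Rightarrow>\<^sub>C real) \<Rightarrow> real. bounded_linear \<phi> \<Longrightarrow> bounded (\<phi> ` F)"
  shows "bounded F"
proof -
  define C :: "nat \<Rightarrow> (('a \<Rightarrow>\<^sub>C real) \<Rightarrow>\<^sub>L real) set"
    where "C n = {\<phi>. \<forall>f\<in>F. \<bar>blinfun_apply \<phi> f\<bar> \<le> n}" for n
  have "C n = (\<Inter>f\<in>F. {\<phi>. \<bar>blinfun_apply \<phi> f\<bar> \<le> n})" for n
    by (auto simp: C_def)
  then have "closed (C n)" for n
    by (auto intro!: closed_INT closed_Collect_le continuous_intros)
  moreover have "(\<Union>n. C n) = UNIV"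
  proof -
    have "\<exists>n. \<phi> \<in> C n" for \<phi>
    proof -
      obtain B where "\<And>f. f \<in> F \<Longrightarrow> \<bar>blinfun_apply \<phi> f\<bar> \<le> B"
        using assms[OF blinfun.bounded_linear_right, of \<phi>] by (auto simp: bounded_iff)
      moreover obtain n where "B \<le> real n" using real_arch_simple by blast
      ultimately show ?thesis unfolding C_def by (auto intro!: exI[of _ n] intro: order_trans)
    qed
    then show ?thesis by auto
  qed
  ultimately obtain n \<phi> r where r: "r > 0" and sub: "cball \<phi> r \<subseteq> C n"
    by (rule closed_cover_contains_cball[OF complete_UNIV])
  have "norm f \<le> 2 * real n / r" if "f \<in> F" for f
  proof (rule norm_bound)
    fix x
    define \<delta> where "\<delta> = Blinfun (\<lambda>f :: 'a \<Rightarrow>\<^sub>C real. apply_bcontfun f x)"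
    have \<delta>: "blinfun_apply \<delta> g = g x" for g
      unfolding \<delta>_def by (simp add: bounded_linear_Blinfun_apply bounded_linear_apply_bcontfun)
    have "norm \<delta> \<le> 1"
      by (rule norm_blinfun_bound) (simp_all add: \<delta> abs_apply_bcontfun_le_norm)
    \<comment> \<open>Moving the centre by \<open>r\<close> times an evaluation stays in the ball;
      comparing the bounds at both functionals isolates \<open>r * f x\<close>.\<close>
    then have "\<phi> + r *\<^sub>R \<delta> \<in> cball \<phi> r" 
      using r by (simp add: dist_norm mult_left_le)
    moreover have "\<phi> \<in> cball \<phi> r" using r by simp
    ultimately have "\<phi> + r *\<^sub>R \<delta> \<in> C n" "\<phi> \<in> C n"
      using sub by blast+
    then have "\<bar>blinfun_apply \<phi> f + r * f x\<bar> \<le> n" "\<bar>blinfun_apply \<phi> f\<bar> \<le> n"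
      using that by (auto simp: C_def plus_blinfun.rep_eq scaleR_blinfun.rep_eq \<delta>)
    then have "r * \<bar>f x\<bar> \<le> 2 * n"
      using r by (auto simp: abs_if split: if_splits)
    then show "norm (f x) \<le> 2 * real n / r"
      using r by (simp add: field_simps)
  qed
  then show ?thesis by (auto simp: bounded_iff)
qed

subsection \<open>Pointwise closures over scattered compact spaces\<close>

lemma compact_t2_Urysohn:
  fixes S T :: "'a::t2_space set"
  assumes "compact (UNIV :: 'a set)" "closed S" "closed T" "S \<inter> T = {}"
  obtains g :: "'a \<Rightarrow> real" where "continuous_on UNIV g"
    "\<And>x. x \<in> S \<Longrightarrow> g x = 0" "\<And>x. x \<in> T \<Longrightarrow> g x = 1"
proof -
  have "Hausdorff_space (euclidean :: 'a topology)"
    unfolding Hausdorff_space_def using hausdorff by (auto simp: disjnt_def)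
  then have "normal_space (euclidean :: 'a topology)"
    using assms(1) by (intro compact_Hausdorff_or_regular_imp_normal_space) (auto simp: compact_space_def)
  then obtain g where "continuous_map euclidean euclideanreal g" "g ` S \<subseteq> {0::real}" "g ` T \<subseteq> {1}"
    by (rule Urysohn_lemma_alt[where S = S and T = T]) (use assms in \<open>auto simp: disjnt_def\<close>)
  then show thesis using that[of g] by auto
qed

text \<open>Let \<open>M\<close> collect the points all of whose neighbourhoods have uncountable
  image. By compactness a closed set missing \<open>M\<close> has countable image. If
  \<open>M\<close> were nonempty it would have an isolated point \<open>x\<close>, and near
  \<open>x\<close> the image is covered by \<open>e x\<close> and countably many images of closed
  sets missing \<open>M\<close>, a contradiction.\<close>

lemma countable_range_scattered:
  fixes a :: "nat \<Rightarrow> 'a::t2_space \<Rightarrow> real"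
  assumes comp: "compact (UNIV :: 'a set)" and scat: "scattered (UNIV :: 'a set)"
    and cont: "\<And>k. continuous_on UNIV (a k)"
  shows "countable (range (\<lambda>x k. a k x))"
proof -
  define e where "e x = (\<lambda>k. a k x)" for x
  define M where "M = {x. \<forall>U. open U \<longrightarrow> x \<in> U \<longrightarrow> \<not> countable (e ` U)}"
  have countable_off_M: "countable (e ` C)" if C: "closed C" "C \<inter> M = {}" for C
  proof -
    have "\<forall>x\<in>C. \<exists>U. open U \<and> x \<in> U \<and> countable (e ` U)"
      using C by (auto simp: M_def)
    then obtain U where U: "\<And>x. x \<in> C \<Longrightarrow> open (U x) \<and> x \<in> U x \<and> countable (e ` U x)"
      by metis
    have "compact C" using comp C compact_Int_closed[of UNIV C] by simp
    then obtain D where "D \<subseteq> C" "finite D" "C \<subseteq> (\<Union>x\<in>D. U x)"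
      by (rule compactE_image[where C = C and f = U]) (use U in auto)
    then have "e ` C \<subseteq> (\<Union>x\<in>D. e ` U x)" by blast
    moreover have "countable (\<Union>x\<in>D. e ` U x)"
      using U \<open>D \<subseteq> C\<close> \<open>finite D\<close> by (intro countable_UN countable_finite[of D]) auto
    ultimately show ?thesis by (rule countable_subset)
  qed
  have "M = {}"
  proof (rule ccontr)
    assume "M \<noteq> {}"
    then have "\<not> dense_in_itself M"
      using scat unfolding scattered_def by blast
    then obtain x where "x \<in> M" "\<not> x islimpt M"
      unfolding dense_in_itself_def by auto
    then obtain U where U: "x \<in> U" "open U" "\<And>y. y \<in> M \<Longrightarrow> y \<in> U \<Longrightarrow> y = x"
      unfolding islimpt_def by blast
    \<comment> \<open>The set where \<open>g \<le> 1/2\<close> is a closed neighbourhood of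
      \<open>x\<close> meeting \<open>M\<close> only in \<open>x\<close>. The sets
      \<open>C k n\<close> below exclude \<open>x\<close>, hence miss \<open>M\<close>.\<close>
    obtain g :: "'a \<Rightarrow> real" where g: "continuous_on UNIV g" "g x = 0" "\<And>y. y \<notin> U \<Longrightarrow> g y = 1"
      by (rule compact_t2_Urysohn[OF comp, of "{x}" "- U"]) (use U in auto)
    define C where "C k n = {y. g y \<le> 1/2} \<inter> {y. 1 / real (Suc n) \<le> \<bar>a k y - a k x\<bar>}" for k n
    have "countable (e ` C k n)" for k n
    proof (rule countable_off_M)
      show "closed (C k n)"
        unfolding C_def using g(1) cont
        by (intro closed_Int closed_Collect_le continuous_intros) auto
      show "C k n \<inter> M = {}"
        unfolding C_def using U(3) g(3) by force
    qed
    then have "countable (insert (e x) (\<Union>k n. e ` C k n))" by auto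
    moreover have "e ` {y. g y < 1/2} \<subseteq> insert (e x) (\<Union>k n. e ` C k n)"
    proof clarsimp
      fix y assume y: "g y * 2 < 1" "\<forall>k n. e y \<notin> e ` C k n"
      show "e y = e x"
      proof (rule ccontr)
        assume "e y \<noteq> e x"
        then obtain k where "a k y \<noteq> a k x" by (auto simp: e_def)
        then obtain n where "1 / real (Suc n) < \<bar>a k y - a k x\<bar>"
          using reals_Archimedean[of "\<bar>a k y - a k x\<bar>"] by (auto simp: inverse_eq_divide)
        then have "y \<in> C k n" using y by (simp add: C_def)
        then show False using y by blast
      qed
    qed
    ultimately have "countable (e ` {y. g y < 1/2})"
      using countable_subset by blast
    moreover have "open {y. g y < 1/2}"
      using g(1) by (intro open_Collect_less continuous_intros)
    ultimately show False
      using \<open>x \<in> M\<close> g(2) by (auto simp: M_def)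
  qed
  then show ?thesis using countable_off_M[of UNIV] by (simp add: e_def)
qed

text \<open>Finite subsets of the space with at most \<open>m\<close> points are encoded as the first \<open>m\<close> entries of a
  sequence, so that the compactness of a single space of sequences serves all \<open>m\<close> at once.\<close>

lemma countable_tightness_compact:
  fixes A :: "('a::t2_space \<Rightarrow> real) set"
  assumes comp: "compact (UNIV :: 'a set)"
    and cont: "\<And>f. f \<in> A \<Longrightarrow> continuous_on UNIV f" "continuous_on UNIV u"
    and clos: "\<And>F e. finite F \<Longrightarrow> e > 0 \<Longrightarrow> \<exists>f\<in>A. \<forall>x\<in>F. \<bar>f x - u x\<bar> < e"
  obtains B where "countable B" "B \<subseteq> A"
    "\<And>(z :: nat \<Rightarrow> 'a) m. \<exists>f\<in>B. \<forall>i<m. \<bar>f (z i) - u (z i)\<bar> < 1 / real (Suc m)"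
proof -
  have "compact_space (euclidean :: 'a topology)"
    using comp by (simp add: compact_space_def)
  then have "compact_space (product_topology (\<lambda>_. euclidean :: 'a topology) (UNIV :: nat set))"
    unfolding compact_space_product_topology by simp
  then have seq: "compact (UNIV :: (nat \<Rightarrow> 'a) set)"
    by (simp add: compact_space_def euclidean_product_topology)
  have "\<exists>B. finite B \<and> B \<subseteq> A \<and>
      (\<forall>z :: nat \<Rightarrow> 'a. \<exists>f\<in>B. \<forall>i<m. \<bar>f (z i) - u (z i)\<bar> < 1 / real (Suc m))" for m
  proof -
    \<comment> \<open>\<open>W f\<close> depends on the first \<open>m\<close> coordinates only,
      hence is open; these sets cover the sequence space, which is compact by Tychonoff.\<close>
    define W where "W f = (\<Inter>i\<in>{..<m}. {z :: nat \<Rightarrow> 'a. \<bar>f (z i) - u (z i)\<bar> < 1 / real (Suc m)})" for f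
    have "open (W f)" if "f \<in> A" for f
    proof -
      have "continuous_on UNIV (\<lambda>z :: nat \<Rightarrow> 'a. g (z i))" if "continuous_on UNIV g" for g :: "'a \<Rightarrow> real" and i
        by (rule continuous_on_compose2[OF that continuous_on_product_coordinates]) simp
      then show ?thesis
        unfolding W_def using cont that
        by (intro open_INT open_Collect_less continuous_intros ballI) auto
    qed
    moreover have "UNIV \<subseteq> (\<Union>f\<in>A. W f)"
    proof
      fix z :: "nat \<Rightarrow> 'a"
      obtain f where "f \<in> A" "\<forall>x\<in>z ` {..<m}. \<bar>f x - u x\<bar> < 1 / real (Suc m)"
        using clos[of "z ` {..<m}" "1 / real (Suc m)"] by auto
      then show "z \<in> (\<Union>f\<in>A. W f)" by (auto simp: W_def)
    qed
    ultimately obtain B where B: "B \<subseteq> A" "finite B" "UNIV \<subseteq> (\<Union>f\<in>B. W f)"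
      using seq by (rule_tac compactE_image[of UNIV A W])
    have "\<exists>f\<in>B. \<forall>i<m. \<bar>f (z i) - u (z i)\<bar> < 1 / real (Suc m)" for z
    proof -
      obtain f where "f \<in> B" "z \<in> W f" using B(3) by blast
      then show ?thesis by (intro bexI[of _ f]) (simp_all add: W_def)
    qed
    then show ?thesis using B by (intro exI[of _ B]) simp
  qed
  then obtain B where B: "\<And>m. finite (B m)" "\<And>m. B m \<subseteq> A"
    "\<And>m (z :: nat \<Rightarrow> 'a). \<exists>f\<in>B m. \<forall>i<m. \<bar>f (z i) - u (z i)\<bar> < 1 / real (Suc m)"
    by metis
  show thesis
  proof (rule that[of "\<Union>m. B m"])
    show "countable (\<Union>m. B m)" using B(1) by (auto intro: countable_finite)
    show "(\<Union>m. B m) \<subseteq> A" using B(2) by blast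
    fix z :: "nat \<Rightarrow> 'a" and m
    obtain f where "f \<in> B m" "\<forall>i<m. \<bar>f (z i) - u (z i)\<bar> < 1 / real (Suc m)"
      using B(3) by blast
    then show "\<exists>f\<in>\<Union>m. B m. \<forall>i<m. \<bar>f (z i) - u (z i)\<bar> < 1 / real (Suc m)"
      by (intro bexI[of _ f]) auto
  qed
qed

text \<open>A countable \<open>B\<close> already approximates \<open>u\<close> on all finite sets.
  Since \<open>u\<close> and \<open>B\<close> have only countably many joint values, it suffices to
  converge at countably many representative points, and a diagonal choice does that.\<close>

lemma pointwise_closure_sequence_scattered:
  fixes A :: "('a::t2_space \<Rightarrow> real) set"
  assumes comp: "compact (UNIV :: 'a set)" and scat: "scattered (UNIV :: 'a set)"
    and cont: "\<And>f. f \<in> A \<Longrightarrow> continuous_on UNIV f" "continuous_on UNIV u"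
    and clos: "\<And>F e. finite F \<Longrightarrow> e > 0 \<Longrightarrow> \<exists>f\<in>A. \<forall>x\<in>F. \<bar>f x - u x\<bar> < e"
  obtains b where "\<And>n. b n \<in> A" "\<And>x. (\<lambda>n. b n x) \<longlonglongrightarrow> u x"
proof -
  obtain B where B: "countable B" "B \<subseteq> A"
    "\<And>(z :: nat \<Rightarrow> 'a) m. \<exists>f\<in>B. \<forall>i<m. \<bar>f (z i) - u (z i)\<bar> < 1 / real (Suc m)"
    by (rule countable_tightness_compact[OF comp cont clos]) auto
  \<comment> \<open>Including \<open>u\<close> in the enumeration ensures that points with equal
    joint values also agree under \<open>u\<close>; it also makes the enumerated set
    nonempty.\<close>
  define a where "a = from_nat_into (insert u B)"
  have range_a: "range a = insert u B"
    unfolding a_def using B(1) by (intro range_from_nat_into) auto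
  define e where "e x = (\<lambda>k. a k x)" for x
  have "continuous_on UNIV (a k)" for k
    using range_a cont B(2) by (metis insert_iff rangeI subsetD)
  then have "countable (range e)"
    unfolding e_def by (rule countable_range_scattered[OF comp scat])
  then have "range (from_nat_into (range e)) = range e"
    by (intro range_from_nat_into) auto
  then have "\<exists>x. from_nat_into (range e) j = e x" for j
    by (metis rangeE rangeI)
  then obtain z where z: "\<And>j. from_nat_into (range e) j = e (z j)" by metis
  have same: "\<exists>j. \<forall>f\<in>insert u B. f x = f (z j)" for x
  proof -
    obtain j where "e (z j) = e x"
      using \<open>range (from_nat_into (range e)) = range e\<close> z by (metis rangeE rangeI)
    then have "a k x = a k (z j)" for k by (metis e_def)
    then show ?thesis using range_a by (metis rangeE)
  qed
  \<comment> \<open>\<open>b m\<close> is \<open>1 / (m + 1)\<close>-close to \<open>u\<close> at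
    the first \<open>m\<close> representatives, so each fixed representative is handled from some
    index on.\<close>
  obtain b where b: "\<And>m. b m \<in> B" "\<And>m i. i < m \<Longrightarrow> \<bar>b m (z i) - u (z i)\<bar> < 1 / real (Suc m)"
    using B(3)[of _ z] by metis
  show thesis
  proof (rule that)
    show "b n \<in> A" for n using b(1) B(2) by blast
    fix x
    obtain j where j: "\<And>f. f \<in> insert u B \<Longrightarrow> f x = f (z j)" using same by blast
    have "\<forall>\<^sub>F m in sequentially. norm (b m x - u x) \<le> 1 / real (Suc m)"
      using eventually_gt_at_top[of j]
    proof eventually_elim
      case (elim m)
      have "b m x = b m (z j)" "u x = u (z j)" using j b(1) by auto
      then show ?case using b(2)[OF elim] by simp
    qed
    then have "(\<lambda>m. b m x - u x) \<longlonglongrightarrow> 0"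
      by (rule Lim_null_comparison) (rule LIMSEQ_Suc[OF lim_1_over_n])
    then show "(\<lambda>m. b m x) \<longlonglongrightarrow> u x" by (rule LIM_zero_cancel)
  qed
qed

subsection \<open>Dominated convergence for functionals on spaces of continuous functions\<close>

text \<open>For a bounded functional on \<open>C(K)\<close> and continuous \<open>F \<ge> 0\<close>,
  this is the integral of \<open>F\<close> against the total variation of the representing measure,
  obtained without measures. \<open>F\<close> is a plain function, so maxima and differences need no
  repackaging.\<close>

definition total_variation ::
    "(('a::topological_space \<Rightarrow>\<^sub>C real) \<Rightarrow> real) \<Rightarrow> ('a \<Rightarrow> real) \<Rightarrow> real" where
  "total_variation \<phi> F = (SUP g \<in> {g. \<forall>x. \<bar>apply_bcontfun g x\<bar> \<le> F x}. \<phi> g)"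

context
  fixes \<phi> :: "('a::topological_space \<Rightarrow>\<^sub>C real) \<Rightarrow> real" and B :: real
  assumes lin: "linear \<phi>" and bound: "\<And>g. \<bar>\<phi> g\<bar> \<le> B * norm g" and B_nonneg: "0 \<le> B"
begin

lemma functional_le_bound:
  assumes "\<And>x. \<bar>apply_bcontfun g x\<bar> \<le> c"
  shows "\<bar>\<phi> g\<bar> \<le> B * c"
proof -
  have "norm g \<le> c" by (rule norm_bound) (use assms in simp)
  then have "B * norm g \<le> B * c" by (rule mult_left_mono[OF _ B_nonneg])
  then show ?thesis using bound[of g] by linarith
qed

text \<open>The uniform bound \<open>c\<close> on \<open>F\<close> makes the values bounded above,
  as a real supremum requires.\<close>

lemma functional_le_total_variation:
  assumes "\<And>x. \<bar>apply_bcontfun g x\<bar> \<le> F x" "\<And>x. F x \<le> c"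
  shows "\<phi> g \<le> total_variation \<phi> F"
  unfolding total_variation_def
proof (rule cSUP_upper)
  show "bdd_above (\<phi> ` {g. \<forall>x. \<bar>apply_bcontfun g x\<bar> \<le> F x})"
  proof (rule bdd_aboveI2)
    fix g assume "g \<in> {g. \<forall>x. \<bar>apply_bcontfun g x\<bar> \<le> F x}"
    then have "\<bar>\<phi> g\<bar> \<le> B * c"
      by (intro functional_le_bound order_trans[OF _ assms(2)]) auto
    then show "\<phi> g \<le> B * c" by simp
  qed
qed (use assms in simp)

lemma total_variation_least:
  assumes "\<And>x. 0 \<le> F x" "\<And>g. (\<And>x. \<bar>apply_bcontfun g x\<bar> \<le> F x) \<Longrightarrow> \<phi> g \<le> c"
  shows "total_variation \<phi> F \<le> c"
  unfolding total_variation_def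
proof (rule cSUP_least)
  have "0 \<in> {g. \<forall>x. \<bar>apply_bcontfun g x\<bar> \<le> F x}" using assms(1) by simp
  then show "{g. \<forall>x. \<bar>apply_bcontfun g x\<bar> \<le> F x} \<noteq> {}" by blast
qed (simp add: assms(2))

lemma total_variation_mono:
  assumes "\<And>x. 0 \<le> F x" "\<And>x. F x \<le> G x" "\<And>x. G x \<le> c"
  shows "total_variation \<phi> F \<le> total_variation \<phi> G"
proof (rule total_variation_least)
  fix g assume "\<And>x. \<bar>apply_bcontfun g x\<bar> \<le> F x"
  then show "\<phi> g \<le> total_variation \<phi> G"
    by (intro functional_le_total_variation[where c = c] order_trans[OF _ assms(2)] assms(3))
qed (fact assms)

lemma total_variation_le_bound:
  assumes "\<And>x. 0 \<le> F x" "\<And>x. F x \<le> c"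
  shows "total_variation \<phi> F \<le> B * c"
proof (rule total_variation_least)
  fix g assume "\<And>x. \<bar>apply_bcontfun g x\<bar> \<le> F x"
  then have "\<bar>\<phi> g\<bar> \<le> B * c"
    by (intro functional_le_bound order_trans[OF _ assms(2)])
  then show "\<phi> g \<le> B * c" by simp
qed (fact assms)

text \<open>Functions dominated by \<open>F\<close> and by \<open>G\<close> add up to one dominated
  by the sum; the two suprema are taken one after the other.\<close>

lemma total_variation_superadditive:
  assumes "\<And>x. 0 \<le> F x" "\<And>x. 0 \<le> G x" "\<And>x. F x + G x \<le> c"
  shows "total_variation \<phi> F + total_variation \<phi> G \<le> total_variation \<phi> (\<lambda>x. F x + G x)"
proof -
  have "total_variation \<phi> F \<le> total_variation \<phi> (\<lambda>x. F x + G x) - total_variation \<phi> G"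
  proof (rule total_variation_least)
    fix f assume f: "\<And>x. \<bar>apply_bcontfun f x\<bar> \<le> F x"
    have "total_variation \<phi> G \<le> total_variation \<phi> (\<lambda>x. F x + G x) - \<phi> f"
    proof (rule total_variation_least)
      fix g assume g: "\<And>x. \<bar>apply_bcontfun g x\<bar> \<le> G x"
      have "\<bar>apply_bcontfun (f + g) x\<bar> \<le> F x + G x" for x
        using f[of x] g[of x] by simp
      then have "\<phi> (f + g) \<le> total_variation \<phi> (\<lambda>x. F x + G x)"
        by (rule functional_le_total_variation) (rule assms)
      then show "\<phi> g \<le> total_variation \<phi> (\<lambda>x. F x + G x) - \<phi> f"
        by (simp add: linear_add[OF lin])
    qed (fact assms)
    then show "\<phi> f \<le> total_variation \<phi> (\<lambda>x. F x + G x) - total_variation \<phi> G" by simp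
  qed (fact assms)
  then show ?thesis by simp
qed

text \<open>Truncating \<open>g\<close> to the band between \<open>-F\<close> and \<open>F\<close>
  splits it into a part dominated by \<open>F\<close> and a remainder dominated by \<open>G\<close>.
  Continuity of \<open>F\<close> makes the truncation a legitimate argument of
  \<open>\<phi>\<close>.\<close>

lemma total_variation_subadditive:
  assumes "\<And>x. 0 \<le> F x" "\<And>x. 0 \<le> G x" "\<And>x. F x \<le> c" "\<And>x. G x \<le> d"
    and cont: "continuous_on UNIV F"
  shows "total_variation \<phi> (\<lambda>x. F x + G x) \<le> total_variation \<phi> F + total_variation \<phi> G"
proof (rule total_variation_least)
  fix g assume g: "\<And>x. \<bar>apply_bcontfun g x\<bar> \<le> F x + G x"
  define f where "f = Bcontfun (\<lambda>x. max (- F x) (min (F x) (apply_bcontfun g x)))"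
  have "(\<lambda>x. max (- F x) (min (F x) (apply_bcontfun g x))) \<in> bcontfun"
  proof (rule bcontfun_normI)
    show "norm (max (- F x) (min (F x) (apply_bcontfun g x))) \<le> c" for x
      using assms(1,3)[of x] by auto
  qed (intro continuous_on_max continuous_on_min continuous_on_minus continuous_on_apply_bcontfun cont)
  then have f: "apply_bcontfun f x = max (- F x) (min (F x) (apply_bcontfun g x))" for x
    unfolding f_def by (simp add: Bcontfun_inverse)
  have "\<phi> f \<le> total_variation \<phi> F"
  proof (rule functional_le_total_variation)
    show "\<bar>apply_bcontfun f x\<bar> \<le> F x" for x
      using assms(1)[of x] by (auto simp: f)
  qed (fact assms)
  moreover have "\<phi> (g - f) \<le> total_variation \<phi> G"
  proof (rule functional_le_total_variation)
    show "\<bar>apply_bcontfun (g - f) x\<bar> \<le> G x" for x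
      using assms(1,2)[of x] g[of x] by (auto simp: f)
  qed (fact assms)
  ultimately show "\<phi> g \<le> total_variation \<phi> F + total_variation \<phi> G"
    by (simp add: linear_diff[OF lin])
qed (use assms in simp)

end

section \<open>Dini's theorem and maxima over finite blocks\<close>

lemma Dini_antimono:
  fixes h :: "nat \<Rightarrow> 'a::topological_space \<Rightarrow> real"
  assumes comp: "compact (UNIV :: 'a set)" and cont: "\<And>n. continuous_on UNIV (h n)"
    and anti: "\<And>x. antimono (\<lambda>n. h n x)" and lim: "\<And>x. (\<lambda>n. h n x) \<longlonglongrightarrow> 0" and "e > 0"
  shows "\<exists>N. \<forall>n\<ge>N. \<forall>x. h n x < e"
proof -
  define U where "U n = {x. h n x < e}" for n
  have opn: "open (U n)" for n
    unfolding U_def using cont by (intro open_Collect_less continuous_on_const)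
  have cover: "UNIV \<subseteq> (\<Union>n. U n)"
  proof
    fix x
    have "\<forall>\<^sub>F n in sequentially. h n x < e"
      by (rule order_tendstoD(2)[OF lim \<open>e > 0\<close>])
    then show "x \<in> (\<Union>n. U n)" by (auto simp: U_def eventually_sequentially)
  qed
  obtain D where D: "finite D" "UNIV \<subseteq> (\<Union>n\<in>D. U n)"
  proof (rule compactE_image[OF comp, where C = UNIV and f = U])
    show "open (U n)" for n by (rule opn)
    show "UNIV \<subseteq> (\<Union>n. U n)" by (rule cover)
  qed (rule that)
  have "h n x < e" if "Max D \<le> n" for n x
  proof -
    have "x \<in> (\<Union>n\<in>D. U n)" using D(2) by blast
    then obtain k where "k \<in> D" "h k x < e" unfolding U_def by blast
    have "k \<le> n"
      using Max_ge[OF D(1) \<open>k \<in> D\<close>] that by (rule order_trans)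
    then have "h n x \<le> h k x"
      by (rule antimonoD[OF anti])
    then show ?thesis using \<open>h k x < e\<close> by simp
  qed
  then show ?thesis by blast
qed

text \<open>The block is \<open>n, ..., n + d\<close>: it has \<open>d + 1\<close> members and is
  never empty.\<close>

primrec max_from :: "(nat \<Rightarrow> 'a \<Rightarrow> real) \<Rightarrow> nat \<Rightarrow> nat \<Rightarrow> 'a \<Rightarrow> real" where
  "max_from F n 0 x = F n x"
| "max_from F n (Suc d) x = max (max_from F n d x) (F (n + Suc d) x)"

lemma max_from_le_iff: "max_from F n d x \<le> c \<longleftrightarrow> (\<forall>k\<le>d. F (n + k) x \<le> c)"
  by (induction d) (auto simp: le_Suc_eq)

lemma le_max_from: "k \<le> d \<Longrightarrow> F (n + k) x \<le> max_from F n d x"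
  using max_from_le_iff[of F n d x "max_from F n d x"] by simp

lemma max_from_mono:
  assumes "d \<le> d'"
  shows "max_from F n d x \<le> max_from F n d' x"
  unfolding max_from_le_iff using assms by (intro allI impI le_max_from) simp

lemma max_from_Suc_le: "max_from F (Suc n) d x \<le> max_from F n (Suc d) x"
  unfolding max_from_le_iff
proof (intro allI impI)
  fix k assume "k \<le> d"
  then show "F (Suc n + k) x \<le> max_from F n (Suc d) x"
    using le_max_from[of "Suc k" "Suc d" F n x] by simp
qed

lemma continuous_on_max_from:
  assumes "\<And>n. continuous_on S (F n)"
  shows "continuous_on S (max_from F n d)"
proof (induction d)
  case 0
  have "max_from F n 0 = F n" by (rule ext) simp
  then show ?case using assms by simp
next
  case (Suc d)
  have "max_from F n (Suc d) = (\<lambda>x. max (max_from F n d x) (F (n + Suc d) x))"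
    by (rule ext) simp
  then show ?case using Suc assms by (auto intro!: continuous_on_max)
qed

text \<open>Daniell's argument: the finite maxima over suitable blocks \<open>n, \<dots>, n + d n\<close> nearly attain the
  supremum of the variations over all such blocks, which makes them almost decreasing in \<open>n\<close>; their
  running minima \<open>H n\<close> are decreasing, and tend to zero uniformly by Dini's theorem.\<close>

lemma total_variation_tendsto_zero:
  fixes \<phi> :: "('a::topological_space \<Rightarrow>\<^sub>C real) \<Rightarrow> real"
  assumes comp: "compact (UNIV :: 'a set)" and \<phi>: "bounded_linear \<phi>"
    and cont: "\<And>n. continuous_on UNIV (F n)" and F0: "\<And>n x. 0 \<le> F n x" and FM: "\<And>n x. F n x \<le> M"
    and lim: "\<And>x. (\<lambda>n. F n x) \<longlonglongrightarrow> 0" and "e > 0"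
  shows "\<forall>\<^sub>F n in sequentially. total_variation \<phi> (F n) < e"
proof -
  let ?v = "total_variation \<phi>"
  obtain B where B: "0 \<le> B" "\<And>g. \<bar>\<phi> g\<bar> \<le> B * norm g"
    using bounded_linear.nonneg_bounded[OF \<phi>] by (auto simp: mult.commute)
  note tv = bounded_linear.linear[OF \<phi>] B(2,1)
  define \<delta> where "\<delta> = e / 4"
  have "\<delta> > 0" using \<open>e > 0\<close> by (simp add: \<delta>_def)
  define G where "G = max_from F"
  have G0: "0 \<le> G n d x" for n d x
    using le_max_from[of 0 d F n x] F0[of n x] by (simp add: G_def)
  have GM: "G n d x \<le> M" for n d x
    using FM by (simp add: G_def max_from_le_iff)
  define s where "s n = (SUP d. ?v (G n d))" for n
  have "bdd_above (range (\<lambda>d. ?v (G n d)))" for n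
    by (rule bdd_aboveI2) (rule total_variation_le_bound[OF tv G0 GM])
  then have s: "?v (G n d) \<le> s n" for n d
    unfolding s_def by (rule cSUP_upper[OF UNIV_I])
  \<comment> \<open>The tolerances are geometric so that the errors accumulated in
    \<open>gap\<close> sum to less than \<open>\<delta>\<close>.\<close>
  have "\<exists>d. s n - \<delta> / 2 ^ Suc n < ?v (G n d)" for n
  proof (rule ccontr)
    assume "\<nexists>d. s n - \<delta> / 2 ^ Suc n < ?v (G n d)"
    then have "s n \<le> s n - \<delta> / 2 ^ Suc n"
      unfolding s_def by (intro cSUP_least) (auto simp: not_less)
    then show False using \<open>\<delta> > 0\<close> by (simp add: field_simps)
  qed
  then obtain d where d: "\<And>n. s n - \<delta> / 2 ^ Suc n < ?v (G n (d n))" by metis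
  define P where "P n = G n (d n)" for n
  have P0: "0 \<le> P n x" and PM: "P n x \<le> M" for n x
    using G0 GM by (auto simp: P_def)
  have contP: "continuous_on UNIV (P n)" for n
    unfolding P_def G_def by (rule continuous_on_max_from[OF cont])
  \<comment> \<open>Both \<open>P n\<close> and \<open>P (Suc n)\<close> lie below one block maximum
    starting at \<open>n\<close>, so their maximum has variation at most \<open>s n\<close>. As
    \<open>P n\<close> nearly attains \<open>s n\<close>, superadditivity leaves only the tolerance
    for the difference.\<close>
  have step: "?v (\<lambda>x. max (P n x) (P (Suc n) x) - P n x) \<le> \<delta> / 2 ^ Suc n" for n
  proof -
    let ?D = "max (d n) (Suc (d (Suc n)))"
    have "max (P n x) (P (Suc n) x) \<le> G n ?D x" for x
    proof (rule max.boundedI)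
      show "P n x \<le> G n ?D x"
        unfolding P_def G_def by (rule max_from_mono) simp
      have "P (Suc n) x \<le> G n (Suc (d (Suc n))) x"
        unfolding P_def G_def by (rule max_from_Suc_le)
      also have "\<dots> \<le> G n ?D x"
        unfolding P_def G_def by (rule max_from_mono) simp
      finally show "P (Suc n) x \<le> G n ?D x" .
    qed
    then have "?v (\<lambda>x. max (P n x) (P (Suc n) x)) \<le> ?v (G n ?D)"
      by (intro total_variation_mono[OF tv _ _ GM]) (use P0 in \<open>auto simp: le_max_iff_disj\<close>)
    also have "\<dots> \<le> s n" by (rule s)
    finally have "?v (\<lambda>x. max (P n x) (P (Suc n) x)) \<le> s n" .
    moreover have "?v (P n) + ?v (\<lambda>x. max (P n x) (P (Suc n) x) - P n x)
        \<le> ?v (\<lambda>x. P n x + (max (P n x) (P (Suc n) x) - P n x))"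
      by (rule total_variation_superadditive[OF tv, where c = M]) (use P0 PM in auto)
    ultimately show ?thesis using d[of n] by (simp add: P_def)
  qed
  define H where "H = rec_nat (P 0) (\<lambda>n h x. min (h x) (P (Suc n) x))"
  have H_0: "H 0 = P 0" and H_Suc: "H (Suc n) = (\<lambda>x. min (H n x) (P (Suc n) x))" for n
    by (simp_all add: H_def)
  have H0: "0 \<le> H n x" for n x
    by (induction n) (use P0 in \<open>auto simp: H_0 H_Suc\<close>)
  have HP: "H n x \<le> P n x" for n x
    by (cases n) (auto simp: H_0 H_Suc)
  have contH: "continuous_on UNIV (H n)" for n
    by (induction n) (use contP in \<open>auto simp: H_0 H_Suc intro!: continuous_on_min\<close>)
  have antiH: "antimono (\<lambda>n. H n x)" for x
    by (rule decseq_SucI) (simp add: H_Suc)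
  have gap: "?v (\<lambda>x. P n x - H n x) \<le> \<delta> * (1 - 1 / 2 ^ n)" for n
  proof (induction n)
    case 0
    show ?case
      using total_variation_le_bound[OF tv, of "\<lambda>x. 0" 0] by (simp add: H_0)
  next
    case (Suc n)
    \<comment> \<open>The right side equals \<open>max (P n x) (P (Suc n) x) - H n x\<close>, which
      dominates \<open>0\<close> and \<open>P (Suc n) x - H n x\<close>, the two possible values on
      the left.\<close>
    have "?v (\<lambda>x. P (Suc n) x - H (Suc n) x)
        \<le> ?v (\<lambda>x. (P n x - H n x) + (max (P n x) (P (Suc n) x) - P n x))"
    proof (rule total_variation_mono[OF tv, where c = M])
      fix x
      show "0 \<le> P (Suc n) x - H (Suc n) x" using HP[of "Suc n" x] by simp
      show "P (Suc n) x - H (Suc n) x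
          \<le> (P n x - H n x) + (max (P n x) (P (Suc n) x) - P n x)"
        using HP[of n x] by (auto simp: H_Suc)
      show "(P n x - H n x) + (max (P n x) (P (Suc n) x) - P n x) \<le> M"
        using PM[of n x] PM[of "Suc n" x] H0[of n x] by simp
    qed
    also have "\<dots> \<le> ?v (\<lambda>x. P n x - H n x) + ?v (\<lambda>x. max (P n x) (P (Suc n) x) - P n x)"
    proof (rule total_variation_subadditive[OF tv, where c = M and d = M])
      fix x
      show "0 \<le> P n x - H n x" using HP by simp
      show "P n x - H n x \<le> M" using PM[of n x] H0[of n x] by simp
      show "max (P n x) (P (Suc n) x) - P n x \<le> M"
        using PM[of n x] PM[of "Suc n" x] P0[of n x] by simp
    qed (auto intro!: continuous_intros contP contH)
    also have "\<dots> \<le> \<delta> * (1 - 1 / 2 ^ n) + \<delta> / 2 ^ Suc n"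
      by (intro add_mono Suc.IH step)
    also have "\<dots> = \<delta> * (1 - 1 / 2 ^ Suc n)" by (simp add: field_simps)
    finally show ?case .
  qed
  have limP: "(\<lambda>n. P n x) \<longlonglongrightarrow> 0" for x
  proof (rule LIMSEQ_I)
    fix r :: real assume "r > 0"
    then obtain N where N: "\<And>n. n \<ge> N \<Longrightarrow> F n x < r / 2"
      using order_tendstoD(2)[OF lim, of "r / 2" x] by (auto simp: eventually_sequentially)
    have "norm (P n x - 0) < r" if "n \<ge> N" for n
    proof -
      have "F (n + k) x \<le> r / 2" for k using N[of "n + k"] that by simp
      then have "P n x \<le> r / 2" unfolding P_def G_def max_from_le_iff by simp
      then show ?thesis using P0[of n x] \<open>r > 0\<close> by simp
    qed
    then show "\<exists>N. \<forall>n\<ge>N. norm (P n x - 0) < r" by blast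
  qed
  have limH: "(\<lambda>n. H n x) \<longlonglongrightarrow> 0" for x
    using H0[of _ x] HP[of _ x] tendsto_const limP[of x]
    by (intro tendsto_sandwich[of "\<lambda>_. 0" "\<lambda>n. H n x" sequentially "\<lambda>n. P n x"] always_eventually) auto
  \<comment> \<open>Dividing by \<open>B + 1\<close> keeps the quotient positive even for
    \<open>B = 0\<close>, and multiplying back by \<open>B\<close> yields at most
    \<open>\<delta>\<close>.\<close>
  obtain N where N: "\<And>n x. n \<ge> N \<Longrightarrow> H n x < \<delta> / (B + 1)"
    using Dini_antimono[OF comp contH antiH limH, of "\<delta> / (B + 1)"] \<open>\<delta> > 0\<close> B(1) by auto
  have "?v (F n) < e" if "n \<ge> N" for n
  proof -
    \<comment> \<open>\<open>F n\<close> is the first entry of its own block, hence below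
      \<open>P n\<close>; what follows splits \<open>P n\<close> into \<open>H n\<close>, small by
      Dini, and the gap. Two errors of \<open>e / 4\<close> keep the result below
      \<open>e\<close>.\<close>
    have "?v (F n) \<le> ?v (\<lambda>x. H n x + (P n x - H n x))"
    proof (rule total_variation_mono[OF tv F0, where c = M])
      show "F n x \<le> H n x + (P n x - H n x)" for x
        using le_max_from[of 0 "d n" F n x] by (simp add: P_def G_def)
    qed (use PM in simp)
    also have "\<dots> \<le> ?v (H n) + ?v (\<lambda>x. P n x - H n x)"
    proof (rule total_variation_subadditive[OF tv, where c = M and d = M])
      fix x
      show "H n x \<le> M" using HP[of n x] PM[of n x] by simp
      show "P n x - H n x \<le> M" using PM[of n x] H0[of n x] by simp
    qed (use H0 HP contH in auto)
    also have "?v (H n) \<le> B * (\<delta> / (B + 1))"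
      by (rule total_variation_le_bound[OF tv H0]) (rule less_imp_le[OF N[OF that]])
    also have "B * (\<delta> / (B + 1)) \<le> \<delta>"
      using B(1) \<open>\<delta> > 0\<close> by (simp add: field_simps)
    also have "?v (\<lambda>x. P n x - H n x) \<le> \<delta>"
      by (rule order_trans[OF gap]) (use \<open>\<delta> > 0\<close> in \<open>simp add: field_simps\<close>)
    finally show ?thesis using \<open>\<delta> > 0\<close> by (simp add: \<delta>_def)
  qed
  then show ?thesis by (auto simp: eventually_sequentially)
qed

text \<open>Dominated convergence: \<open>\<bar>\<phi> (f n - l)\<bar>\<close> is at most the
  variation of \<open>\<bar>f n - l\<bar>\<close>, and these functions are continuous, uniformly
  bounded and pointwise null.\<close>

lemma bounded_pointwise_convergent_imp_weakly_convergent: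
  fixes f :: "nat \<Rightarrow> 'a::topological_space \<Rightarrow>\<^sub>C real"
  assumes comp: "compact (UNIV :: 'a set)" and bd: "\<And>n. norm (f n) \<le> M"
    and lim: "\<And>x. (\<lambda>n. apply_bcontfun (f n) x) \<longlonglongrightarrow> apply_bcontfun l x"
  shows "limitin weak_topology f l sequentially"
  unfolding limitin_weak_topology
proof (intro allI impI)
  fix \<phi> :: "('a \<Rightarrow>\<^sub>C real) \<Rightarrow> real"
  assume \<phi>: "bounded_linear \<phi>"
  obtain B where B: "0 \<le> B" "\<And>g. \<bar>\<phi> g\<bar> \<le> B * norm g"
    using bounded_linear.nonneg_bounded[OF \<phi>] by (auto simp: mult.commute)
  define F where "F n x = \<bar>apply_bcontfun (f n - l) x\<bar>" for n x
  have FM: "F n x \<le> M + norm l" for n x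
    unfolding F_def using abs_apply_bcontfun_le_norm[of "f n - l" x] norm_triangle_ineq4[of "f n" l] bd[of n]
    by linarith
  have le: "\<bar>\<phi> (f n - l)\<bar> \<le> total_variation \<phi> (F n)" for n
  proof (rule abs_leI)
    have "\<phi> (f n - l) \<le> total_variation \<phi> (F n)" "\<phi> (- (f n - l)) \<le> total_variation \<phi> (F n)"
      by (rule functional_le_total_variation[OF bounded_linear.linear[OF \<phi>] B(2,1) _ FM], simp add: F_def)+
    then show "\<phi> (f n - l) \<le> total_variation \<phi> (F n)" "- \<phi> (f n - l) \<le> total_variation \<phi> (F n)"
      by (simp_all only: linear_neg[OF bounded_linear.linear[OF \<phi>]])
  qed
  have "(\<lambda>n. F n x) \<longlonglongrightarrow> 0" for x
    unfolding F_def using LIM_zero[OF lim[of x]] by (simp add: tendsto_rabs_zero)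
  then have ev: "\<forall>\<^sub>F n in sequentially. total_variation \<phi> (F n) < e" if "e > 0" for e
    using that FM by (intro total_variation_tendsto_zero[OF comp \<phi>])
      (auto simp: F_def[abs_def] intro!: continuous_intros)
  have "(\<lambda>n. \<phi> (f n - l)) \<longlonglongrightarrow> 0"
    unfolding tendsto_iff
  proof (intro allI impI)
    fix e :: real assume "e > 0"
    from ev[OF this] show "\<forall>\<^sub>F n in sequentially. dist (\<phi> (f n - l)) 0 < e"
    proof eventually_elim
      case (elim n)
      then show ?case using le[of n] by (simp add: dist_real_def)
    qed
  qed
  then have "(\<lambda>n. \<phi> (f n) - \<phi> l) \<longlonglongrightarrow> 0"
    by (simp only: linear_diff[OF bounded_linear.linear[OF \<phi>]])
  then show "(\<lambda>n. \<phi> (f n)) \<longlonglongrightarrow> \<phi> l"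
    by (rule LIM_zero_cancel)
qed

subsection \<open>The Frechet--Urysohn property in the weak topology\<close>

text \<open>Urysohn functions that are 1 at one of \<open>card B + 1\<close> chosen points and 0 at
  the others are independent, too many for the span of \<open>B\<close>.\<close>

lemma not_span_finite_bcontfun:
  assumes comp: "compact (UNIV :: 'a::t2_space set)" and inf: "infinite (UNIV :: 'a set)"
    and "finite B"
  shows "\<not> (UNIV :: ('a \<Rightarrow>\<^sub>C real) set) \<subseteq> span B"
proof
  assume span: "(UNIV :: ('a \<Rightarrow>\<^sub>C real) set) \<subseteq> span B"
  obtain X :: "'a set" where X: "finite X" "card X = Suc (card B)"
    using infinite_arbitrarily_large[OF inf] by blast
  have "\<exists>g :: 'a \<Rightarrow>\<^sub>C real. g x = 1 \<and> (\<forall>y\<in>X - {x}. g y = 0)" for x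
  proof -
    obtain g :: "'a \<Rightarrow> real" where g: "continuous_on UNIV g"
      "\<And>y. y \<in> X - {x} \<Longrightarrow> g y = 0" "g x = 1"
      by (rule compact_t2_Urysohn[OF comp, of "X - {x}" "{x}"])
        (use X(1) in \<open>auto intro: finite_imp_closed\<close>)
    have "g \<in> range (apply_bcontfun :: ('a \<Rightarrow>\<^sub>C real) \<Rightarrow> 'a \<Rightarrow> real)"
      unfolding range_apply_bcontfun_compact[OF comp] using g(1) by simp
    then obtain h :: "'a \<Rightarrow>\<^sub>C real" where "g = apply_bcontfun h" by blast
    then show ?thesis using g by (intro exI[of _ h]) simp
  qed
  then obtain E :: "'a \<Rightarrow> 'a \<Rightarrow>\<^sub>C real" where E: "\<And>x. E x x = 1"
    "\<And>x y. y \<in> X \<Longrightarrow> y \<noteq> x \<Longrightarrow> E x y = 0"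
    by (metis DiffI singletonD)
  have inj: "inj_on E X"
    by (rule inj_onI) (metis E zero_neq_one)
  have "independent (E ` X)"
  proof (rule independent_if_scalars_zero)
    fix c v assume sum: "(\<Sum>v\<in>E ` X. c v *\<^sub>R v) = 0" and "v \<in> E ` X"
    then obtain x where x: "x \<in> X" "v = E x" by blast
    interpret ev: bounded_linear "\<lambda>f :: 'a \<Rightarrow>\<^sub>C real. apply_bcontfun f x"
      by (rule bounded_linear_apply_bcontfun)
    have "0 = apply_bcontfun (\<Sum>y\<in>X. c (E y) *\<^sub>R E y) x"
      using sum by (simp add: sum.reindex[OF inj])
    also have "\<dots> = (\<Sum>y\<in>X. c (E y) * apply_bcontfun (E y) x)"
      by (simp add: ev.sum)
    also have "\<dots> = (\<Sum>y\<in>X. if y = x then c (E x) else 0)"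
      by (rule sum.cong) (use E x in auto)
    also have "\<dots> = c v" using x X(1) by simp
    finally show "c v = 0" by simp
  qed (use X(1) in simp)
  then have "card (E ` X) \<le> card B"
    using independent_span_bound[OF \<open>finite B\<close>] span by blast
  then show False using X(2) by (simp add: card_image[OF inj])
qed

text \<open>One more functional lowers the dimension by at most one: modulo a single vector
  \<open>w\<close> the old kernel lies in the new one. \<open>B\<close> is arbitrary in the
  induction so that it can absorb \<open>w\<close>.\<close>

lemma common_kernel_not_span_finite:
  fixes \<Phi> :: "('v::real_vector \<Rightarrow> real) set"
  assumes "\<And>B :: 'v set. finite B \<Longrightarrow> \<not> UNIV \<subseteq> span B"
    and "finite \<Phi>" "\<And>\<phi>. \<phi> \<in> \<Phi> \<Longrightarrow> linear \<phi>" "finite B"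
  shows "\<not> {v. \<forall>\<phi>\<in>\<Phi>. \<phi> v = 0} \<subseteq> span B"
  using assms(2-4)
proof (induction \<Phi> arbitrary: B)
  case empty
  then show ?case using assms(1)[of B] by simp
next
  case (insert \<psi> \<Phi>)
  have \<psi>: "linear \<psi>" using insert.prems by simp
  show ?case
  proof
    assume sub: "{v. \<forall>\<phi>\<in>insert \<psi> \<Phi>. \<phi> v = 0} \<subseteq> span B"
    have "\<not> {v. \<forall>\<phi>\<in>\<Phi>. \<phi> v = 0} \<subseteq> span B"
      using insert by simp
    with sub obtain w where w: "\<forall>\<phi>\<in>\<Phi>. \<phi> w = 0" "\<psi> w \<noteq> 0" by auto
    have "v \<in> span (insert w B)" if v: "\<forall>\<phi>\<in>\<Phi>. \<phi> v = 0" for v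
    proof -
      have "\<phi> (v - (\<psi> v / \<psi> w) *\<^sub>R w) = 0" if "\<phi> \<in> insert \<psi> \<Phi>" for \<phi>
        using v w that insert.prems(1)[OF that]
        by (auto simp: linear_diff linear_scale)
      then have "v - (\<psi> v / \<psi> w) *\<^sub>R w \<in> span B" using sub by blast
      then show ?thesis unfolding span_breakdown_eq by blast
    qed
    moreover have "\<not> {v. \<forall>\<phi>\<in>\<Phi>. \<phi> v = 0} \<subseteq> span (insert w B)"
      using insert by simp
    ultimately show False by blast
  qed
qed

text \<open>Small values at \<open>p\<close> force large norms. A weak neighbourhood of
  \<open>0\<close> leaves room for large norms, whereas a weakly convergent sequence does
  not.\<close>

definition reciprocal_norm_set :: "'a::topological_space \<Rightarrow> ('a \<Rightarrow>\<^sub>C real) set" where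
  "reciprocal_norm_set p = {f. 0 < apply_bcontfun f p \<and> 1 \<le> norm f * apply_bcontfun f p}"

lemma zero_in_closure_reciprocal_norm_set:
  assumes comp: "compact (UNIV :: 'a::t2_space set)" and inf: "infinite (UNIV :: 'a set)"
  shows "0 \<in> weak_topology closure_of reciprocal_norm_set (p :: 'a)"
  unfolding in_closure_of_weak_topology
proof (intro allI impI)
  fix \<Phi> :: "(('a \<Rightarrow>\<^sub>C real) \<Rightarrow> real) set" and e :: real
  assume \<Phi>: "finite \<Phi>" "\<forall>\<phi>\<in>\<Phi>. bounded_linear \<phi>" and "e > 0"
  define one :: "'a \<Rightarrow>\<^sub>C real" where "one = const_bcontfun 1"
  have one: "apply_bcontfun one x = 1" for x by (simp add: one_def const_bcontfun.rep_eq)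
  have "norm one \<le> 1" by (rule norm_bound) (simp add: one)
  define S where "S = (\<Sum>\<phi>\<in>\<Phi>. \<bar>\<phi> one\<bar>)"
  have S: "\<bar>\<phi> one\<bar> \<le> S" if "\<phi> \<in> \<Phi>" for \<phi>
    unfolding S_def using \<Phi>(1) that by (intro member_le_sum) auto
  have "S \<ge> 0" unfolding S_def by (rule sum_nonneg) simp
  \<comment> \<open>Chosen so that \<open>\<delta> * \<bar>\<phi> one\<bar> < e\<close> for all
    \<open>\<phi>\<close> in \<open>\<Phi>\<close> at once; the summand 1 makes this strict and
    avoids division by zero.\<close>
  define \<delta> where "\<delta> = e / (1 + S)"
  have "\<delta> > 0" using \<open>e > 0\<close> \<open>S \<ge> 0\<close> by (simp add: \<delta>_def)
  \<comment> \<open>Evaluation at \<open>p\<close> joins the functionals so that adding multiples of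
    \<open>g\<close> leaves the value at \<open>p\<close> unchanged; \<open>span {}\<close> is the
    zero space, which gives \<open>g \<noteq> 0\<close>.\<close>
  have "\<not> {v. \<forall>\<phi>\<in>insert (\<lambda>f. apply_bcontfun f p) \<Phi>. \<phi> v = 0} \<subseteq> span {}"
    using \<Phi> bounded_linear_apply_bcontfun[of p]
    by (intro common_kernel_not_span_finite not_span_finite_bcontfun[OF comp inf])
      (auto intro: bounded_linear.linear)
  then obtain g where g: "\<And>\<phi>. \<phi> \<in> \<Phi> \<Longrightarrow> \<phi> g = 0" "apply_bcontfun g p = 0" "g \<noteq> 0"
    by auto
  \<comment> \<open>After losing at most \<open>\<delta>\<close> to the constant part, the norm of
    \<open>f\<close> is still at least \<open>1 / \<delta>\<close>, while \<open>f\<close> has value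
    \<open>\<delta>\<close> at \<open>p\<close>.\<close>
  define t where "t = (\<delta> + 1 / \<delta>) / norm g"
  define f where "f = t *\<^sub>R g + \<delta> *\<^sub>R one"
  have "norm (t *\<^sub>R g) = \<delta> + 1 / \<delta>" using g(3) \<open>\<delta> > 0\<close> by (simp add: t_def)
  moreover have "norm (\<delta> *\<^sub>R one) \<le> \<delta>"
    using \<open>norm one \<le> 1\<close> \<open>\<delta> > 0\<close> by (simp add: mult_left_le)
  ultimately have "1 / \<delta> \<le> norm f"
    unfolding f_def using norm_diff_ineq[of "t *\<^sub>R g" "\<delta> *\<^sub>R one"] by simp
  then have "f \<in> reciprocal_norm_set p"
    using \<open>\<delta> > 0\<close> by (simp add: reciprocal_norm_set_def f_def g(2) one field_simps)
  moreover have "\<bar>\<phi> f - \<phi> 0\<bar> < e" if "\<phi> \<in> \<Phi>" for \<phi>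
  proof -
    have lin: "linear \<phi>" using \<Phi>(2) that bounded_linear.linear by blast
    have "\<phi> f - \<phi> 0 = \<delta> * \<phi> one"
      using g(1)[OF that] by (simp add: f_def linear_add[OF lin] linear_scale[OF lin] linear_0[OF lin])
    then have "\<bar>\<phi> f - \<phi> 0\<bar> = \<delta> * \<bar>\<phi> one\<bar>" using \<open>\<delta> > 0\<close> by (simp add: abs_mult)
    also have "\<dots> < \<delta> * (1 + S)"
      using S[OF that] \<open>\<delta> > 0\<close> by simp
    also have "\<dots> = e" using \<open>S \<ge> 0\<close> by (simp add: \<delta>_def)
    finally show ?thesis .
  qed
  ultimately show "\<exists>y\<in>reciprocal_norm_set p. \<forall>\<phi>\<in>\<Phi>. \<bar>\<phi> y - \<phi> 0\<bar> < e" by blast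
qed

text \<open>Weak convergence bounds the norms by some \<open>M\<close>, so the values at
  \<open>p\<close> satisfy \<open>1 \<le> M * f n p\<close> although they tend to
  \<open>0\<close>.\<close>

lemma no_sequence_reciprocal_norm_set:
  assumes "\<And>n. f n \<in> reciprocal_norm_set p"
  shows "\<not> limitin weak_topology f 0 sequentially"
proof
  assume lim: "limitin weak_topology f 0 sequentially"
  have "bounded (range f)"
  proof (rule weakly_bounded_imp_bounded)
    fix \<phi> :: "('a \<Rightarrow>\<^sub>C real) \<Rightarrow> real"
    assume "bounded_linear \<phi>"
    then have "(\<lambda>n. \<phi> (f n)) \<longlonglongrightarrow> \<phi> 0"
      using lim unfolding limitin_weak_topology by blast
    then have "bounded (range (\<lambda>n. \<phi> (f n)))" by (rule convergent_imp_bounded)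
    then show "bounded (\<phi> ` range f)" by (simp add: image_image)
  qed
  then obtain M where M: "\<And>n. norm (f n) \<le> M" by (auto simp: bounded_iff)
  have "(\<lambda>n. apply_bcontfun (f n) p) \<longlonglongrightarrow> 0"
    using lim bounded_linear_apply_bcontfun[of p] unfolding limitin_weak_topology by fastforce
  then have "(\<lambda>n. M * apply_bcontfun (f n) p) \<longlonglongrightarrow> M * 0"
    by (intro tendsto_intros)
  moreover have "1 \<le> M * apply_bcontfun (f n) p" for n
  proof -
    have "1 \<le> norm (f n) * apply_bcontfun (f n) p" "0 < apply_bcontfun (f n) p"
      using assms[of n] by (simp_all add: reciprocal_norm_set_def)
    then show ?thesis using mult_right_mono[OF M[of n]] by (meson less_imp_le order_trans)
  qed
  ultimately have "1 \<le> M * 0"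
    by (intro LIMSEQ_le_const) auto
  then show False by simp
qed

text \<open>Evaluations are bounded functionals, so \<open>u\<close> is in the pointwise closure and
  a pointwise convergent sequence exists; the norm bound upgrades its convergence to weak
  convergence.\<close>

lemma bounded_weak_closure_sequence_scattered:
  fixes A :: "('a::t2_space \<Rightarrow>\<^sub>C real) set"
  assumes comp: "compact (UNIV :: 'a set)" and scat: "scattered (UNIV :: 'a set)"
    and bd: "\<And>f. f \<in> A \<Longrightarrow> norm f \<le> M" and clos: "u \<in> weak_topology closure_of A"
  obtains b where "\<And>n. b n \<in> A" "limitin weak_topology b u sequentially"
proof -
  have clos': "\<exists>f\<in>apply_bcontfun ` A. \<forall>x\<in>F. \<bar>f x - u x\<bar> < e" if "finite F" "e > 0" for F e
  proof -
    let ?\<Phi> = "(\<lambda>x (f :: 'a \<Rightarrow>\<^sub>C real). apply_bcontfun f x) ` F"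
    have "\<exists>y\<in>A. \<forall>\<phi>\<in>?\<Phi>. \<bar>\<phi> y - \<phi> u\<bar> < e"
      using clos[unfolded in_closure_of_weak_topology, rule_format, of ?\<Phi> e] that
        bounded_linear_apply_bcontfun by blast
    then show ?thesis by simp
  qed
  obtain c where c: "\<And>n. c n \<in> apply_bcontfun ` A" "\<And>x. (\<lambda>n. c n x) \<longlonglongrightarrow> u x"
    by (rule pointwise_closure_sequence_scattered[OF comp scat _ _ clos']) auto
  then have "\<exists>g. g \<in> A \<and> c n = apply_bcontfun g" for n by blast
  then obtain b where b: "\<And>n. b n \<in> A" "\<And>n. c n = apply_bcontfun (b n)" by metis
  have "limitin weak_topology b u sequentially"
  proof (rule bounded_pointwise_convergent_imp_weakly_convergent[OF comp])
    show "norm (b n) \<le> M" for n by (rule bd[OF b(1)])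
    show "(\<lambda>n. apply_bcontfun (b n) x) \<longlonglongrightarrow> apply_bcontfun u x" for x
      using c(2)[of x] by (simp add: b(2))
  qed
  with b(1) show thesis by (rule that)
qed

text \<open>The norm topology refines the pointwise one, so each value \<open>h f y\<close> is norm
  continuous in \<open>f\<close>. The sets where \<open>norm (h f) \<le> n\<close> are therefore
  closed, and Baire applies.\<close>

lemma pointwise_weak_bounded_on_cball:
  fixes h :: "('k::topological_space \<Rightarrow>\<^sub>C real) \<Rightarrow> ('s::topological_space \<Rightarrow>\<^sub>C real)"
  assumes h: "continuous_map pointwise_topology weak_topology h"
  obtains f r M where "r > 0" "\<And>g. g \<in> cball f r \<Longrightarrow> norm (h g) \<le> M"
proof -
  have "continuous_map euclidean pointwise_topology (\<lambda>f :: 'k \<Rightarrow>\<^sub>C real. f)"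
    unfolding continuous_map_into_pointwise_topology
    by (simp add: bounded_linear.continuous_on[OF bounded_linear_apply_bcontfun] continuous_on_id)
  then have "continuous_map euclidean weak_topology h"
    using continuous_map_compose[OF _ h] by (fastforce simp: o_def)
  then have "continuous_map euclidean euclideanreal (\<lambda>f. apply_bcontfun (h f) y)" for y
    using continuous_map_compose[OF _ continuous_map_weak_topology[OF bounded_linear_apply_bcontfun[of y]]]
    by (fastforce simp: o_def)
  then have cont: "continuous_on UNIV (\<lambda>f. apply_bcontfun (h f) y)" for y by simp
  define C where "C n = {f. norm (h f) \<le> real n}" for n
  have "C n = (\<Inter>y. {f. \<bar>apply_bcontfun (h f) y\<bar> \<le> real n})" for n
    unfolding C_def by (auto intro: order_trans[OF abs_apply_bcontfun_le_norm] norm_bound)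
  then have "closed (C n)" for n
    using cont by (auto intro!: closed_INT closed_Collect_le continuous_intros)
  moreover have "(\<Union>n. C n) = UNIV"
    using real_arch_simple by (auto simp: C_def)
  ultimately obtain n f r where "r > 0" "cball f r \<subseteq> C n"
    by (rule closed_cover_contains_cball[OF complete_UNIV_bcontfun])
  then have "norm (h g) \<le> real n" if "g \<in> cball f r" for g
    using that unfolding C_def by blast
  with \<open>r > 0\<close> show thesis by (rule that)
qed

theorem theorem5p12:
  assumes "compact (UNIV :: 'k::t2_space set)" and "infinite (UNIV :: 'k set)"
    and "compact (UNIV :: 's::t2_space set)" and "infinite (UNIV :: 's set)"
    and "scattered (UNIV :: 's set)"
  shows "\<not> (pointwise_topology :: ('k \<Rightarrow>\<^sub>C real) topology) homeomorphic_space
           (weak_topology :: ('s \<Rightarrow>\<^sub>C real) topology)"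
proof
  assume "(pointwise_topology :: ('k \<Rightarrow>\<^sub>C real) topology) homeomorphic_space
           (weak_topology :: ('s \<Rightarrow>\<^sub>C real) topology)"
  then obtain h :: "('k \<Rightarrow>\<^sub>C real) \<Rightarrow> ('s \<Rightarrow>\<^sub>C real)" and k
    where h: "continuous_map pointwise_topology weak_topology h"
      and k: "continuous_map weak_topology pointwise_topology k"
      and kh: "\<And>f. k (h f) = f" and hk: "\<And>g. h (k g) = g"
    unfolding homeomorphic_space_def homeomorphic_maps_def by auto
  obtain f0 r M where "r > 0" and M: "\<And>g. g \<in> cball f0 r \<Longrightarrow> norm (h g) \<le> M"
    by (rule pointwise_weak_bounded_on_cball[OF h]) (rule that; simp)
  \<comment> \<open>Scales the range of \<open>arctan\<close> into the interval from
    \<open>-r\<close> to \<open>r\<close>, so that \<open>\<Psi>\<close> below maps all of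
    \<open>C(K)\<close> into the ball about \<open>f0\<close>.\<close>
  define c where "c = r / (pi / 2)"
  have "c > 0" using \<open>r > 0\<close> by (simp add: c_def)
  define \<Psi> where "\<Psi> f = f0 + Bcontfun (\<lambda>x. c * arctan (apply_bcontfun f x))" for f
  have arctan_bound: "\<bar>c * arctan t\<bar> \<le> r" for t
  proof -
    have "\<bar>arctan t\<bar> \<le> pi / 2" using arctan_bounded[of t] by linarith
    then have "c * \<bar>arctan t\<bar> \<le> c * (pi / 2)"
      using \<open>c > 0\<close> by (intro mult_left_mono) simp_all
    then show ?thesis using \<open>c > 0\<close> \<open>r > 0\<close> by (simp add: abs_mult c_def)
  qed
  have "(\<lambda>x. c * arctan (apply_bcontfun f x)) \<in> bcontfun" for f :: "'k \<Rightarrow>\<^sub>C real"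
    by (rule bcontfun_normI[where b = r]) (auto intro!: continuous_intros simp: arctan_bound)
  then have \<Psi>: "apply_bcontfun (\<Psi> f) x = apply_bcontfun f0 x + c * arctan (apply_bcontfun f x)" for f x
    by (simp add: \<Psi>_def Bcontfun_inverse)
  have "\<Psi> f \<in> cball f0 r" for f
    unfolding mem_cball dist_norm
    by (rule norm_bound) (use arctan_bound in \<open>simp add: \<Psi>\<close>)
  then have h\<Psi>: "norm (h (\<Psi> f)) \<le> M" for f by (rule M)
  have cont\<Psi>: "continuous_map pointwise_topology pointwise_topology \<Psi>"
    unfolding continuous_map_into_pointwise_topology
  proof
    fix x
    have "continuous_map euclideanreal euclideanreal (\<lambda>t. apply_bcontfun f0 x + c * arctan t)"
      by (auto intro!: continuous_intros)
    from continuous_map_compose[OF continuous_map_pointwise_topology_apply[of x] this]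
    show "continuous_map pointwise_topology euclideanreal (\<lambda>f. apply_bcontfun (\<Psi> f) x)"
      by (simp add: o_def \<Psi>)
  qed
  \<comment> \<open>Any point of the space serves as base point; \<open>undefined\<close> just names
    one.\<close>
  let ?A = "reciprocal_norm_set (undefined :: 's)"
  have cont: "continuous_map weak_topology weak_topology (\<lambda>g. h (\<Psi> (k g)))"
    using continuous_map_compose[OF continuous_map_compose[OF k cont\<Psi>] h] by (simp add: o_def)
  \<comment> \<open>Continuity carries the accumulation at \<open>0\<close> to the image of
    \<open>?A\<close>, which is norm bounded, so a sequence can be extracted there.\<close>
  have "h (\<Psi> (k 0)) \<in> weak_topology closure_of ((\<lambda>g. h (\<Psi> (k g))) ` ?A)"
    using continuous_map_image_closure_subset[OF cont, of ?A]
      zero_in_closure_reciprocal_norm_set[OF assms(3,4), of undefined] by blast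
  then obtain b where b: "\<And>n. b n \<in> (\<lambda>g. h (\<Psi> (k g))) ` ?A"
    "limitin weak_topology b (h (\<Psi> (k 0))) sequentially"
    by (rule bounded_weak_closure_sequence_scattered[OF assms(3,5), rotated]) (use h\<Psi> in auto)
  from b(1) have "\<exists>g. g \<in> ?A \<and> b n = h (\<Psi> (k g))" for n by blast
  then obtain a where a: "\<And>n. a n \<in> ?A" "\<And>n. b n = h (\<Psi> (k (a n)))" by metis
  \<comment> \<open>Applying \<open>k\<close> cancels the outer \<open>h\<close>; next,
    \<open>\<Psi>\<close> is inverted pointwise through \<open>tan\<close>, which is continuous at
    every value of \<open>arctan\<close>.\<close>
  have "limitin pointwise_topology (\<lambda>n. \<Psi> (k (a n))) (\<Psi> (k 0)) sequentially"
    using continuous_map_limit[OF k b(2)] by (simp add: o_def a(2) kh)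
  then have lim\<Psi>: "(\<lambda>n. apply_bcontfun (\<Psi> (k (a n))) x) \<longlonglongrightarrow> apply_bcontfun (\<Psi> (k 0)) x" for x
    unfolding limitin_pointwise_topology by blast
  have "limitin pointwise_topology (\<lambda>n. k (a n)) (k 0) sequentially"
    unfolding limitin_pointwise_topology
  proof
    fix x
    let ?t = "\<lambda>g. arctan (apply_bcontfun (k g) x)"
    have "(\<lambda>n. (apply_bcontfun (\<Psi> (k (a n))) x - apply_bcontfun f0 x) / c)
        \<longlonglongrightarrow> (apply_bcontfun (\<Psi> (k 0)) x - apply_bcontfun f0 x) / c"
      using \<open>c > 0\<close> by (intro tendsto_intros lim\<Psi>) simp
    then have "(\<lambda>n. ?t (a n)) \<longlonglongrightarrow> ?t 0"
      using \<open>c > 0\<close> by (simp add: \<Psi>)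
    then have "(\<lambda>n. tan (?t (a n))) \<longlonglongrightarrow> tan (?t 0)"
      by (rule isCont_tendsto_compose[OF isCont_tan, rotated]) (rule cos_arctan_not_zero)
    then show "(\<lambda>n. apply_bcontfun (k (a n)) x) \<longlonglongrightarrow> apply_bcontfun (k 0) x"
      by (simp add: tan_arctan)
  qed
  \<comment> \<open>A last application of \<open>h\<close> turns \<open>k (a n)\<close> back into
    \<open>a n\<close>, giving a sequence in \<open>?A\<close> that converges weakly to
    \<open>0\<close>.\<close>
  from continuous_map_limit[OF h this] have "limitin weak_topology a 0 sequentially"
    by (simp add: o_def hk)
  then show False using no_sequence_reciprocal_norm_set[of a undefined, OF a(1)] by blast
qed

end
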